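(* For every $n\in\mathbb{N}$, let $s_n,c_n,e_n$ be the polynomials satisfying $s_n''+s_n=-x^n$, $c_n''+c_n=x^n$ and $e_n'+e_n=x^n$. Define the generating functions $$S(x,t)=\sum_{n=0}^{+\infty}\frac{1}{n!}s_n(x)\,t^n,\qquad C(x,t)=\sum_{n=0}^{+\infty}\frac{1}{n!}c_n(x)\,t^n,\qquad E(x,t)=\sum_{n=0}^{+\infty}\frac{1}{n!}e_n(x)\,t^n .$$ Then $$S(x,t)=\frac{-e^{xt}}{1+t^2},\qquad C(x,t)=\frac{e^{xt}}{1+t^2},\qquad E(x,t)=\frac{e^{xt}}{1+t},$$ and these generating functions are connected by the relation $$-2S(x,t)=2C(x,t)=E(ix,-it)+E(-ix,it).$$
   Context: $\mathbb{N}=\{0,1,2,\dots\}$, $i^2=-1$. In each of the defining differential equations the polynomial solution has degree $n$. A prime denotes differentiation with respect to $x$. *)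

theory Defs
  imports "HOL-Computational_Algebra.Computational_Algebra"
begin

text \<open>
  Each defining equation has the form $q + D q = r$ with $D$ strictly lowering the degree, so it
  has exactly one polynomial solution; the two lemmas below justify speaking of \<open>the\<close> polynomials
  $s_n$, $c_n$, $e_n$.
\<close>

lemma poly_ode1_ex1:
  fixes r :: "complex poly"
  shows "\<exists>!q. pderiv q + q = r"
proof (rule ex_ex1I)
  show "\<exists>q. pderiv q + q = r"
  proof (induction "degree r" arbitrary: r rule: less_induct)
    case less
    show ?case
    proof (cases "degree r = 0")
      case True
      then show ?thesis by (intro exI[of _ r]) (simp add: pderiv_eq_0_iff)
    next
      case False
      then have "degree (pderiv r) < degree r" by (simp add: degree_pderiv)
      from less[OF this] obtain q where "pderiv q + q = pderiv r" by blast
      then have "pderiv (r - q) + (r - q) = r" by (simp add: pderiv_diff algebra_simps)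
      then show ?thesis by blast
    qed
  qed
next
  fix p q :: "complex poly"
  assume "pderiv p + p = r" "pderiv q + q = r"
  then have "pderiv (p - q) = - (p - q)" by (simp add: pderiv_diff algebra_simps eq_diff_eq)
  moreover from this have "degree (p - q) - 1 = degree (p - q)"
    by (metis degree_minus degree_pderiv)
  then have "pderiv (p - q) = 0" by (simp add: pderiv_eq_0_iff)
  ultimately show "p = q" by simp
qed

lemma poly_ode2_ex1:
  fixes r :: "complex poly"
  shows "\<exists>!q. pderiv (pderiv q) + q = r"
proof (rule ex_ex1I)
  show "\<exists>q. pderiv (pderiv q) + q = r"
  proof (induction "degree r" arbitrary: r rule: less_induct)
    case less
    show ?case
    proof (cases "degree r = 0")
      case True
      then have "pderiv r = 0" by (simp add: pderiv_eq_0_iff)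
      then show ?thesis by (intro exI[of _ r]) simp
    next
      case False
      then have "degree (pderiv (pderiv r)) < degree r" by (simp add: degree_pderiv)
      from less[OF this] obtain q where "pderiv (pderiv q) + q = pderiv (pderiv r)" by blast
      then have "pderiv (pderiv (r - q)) + (r - q) = r" by (simp add: pderiv_diff algebra_simps)
      then show ?thesis by blast
    qed
  qed
next
  fix p q :: "complex poly"
  assume "pderiv (pderiv p) + p = r" "pderiv (pderiv q) + q = r"
  then have *: "pderiv (pderiv (p - q)) = - (p - q)"
    by (simp add: pderiv_diff algebra_simps eq_diff_eq)
  then have "degree (p - q) - 1 - 1 = degree (p - q)" by (metis degree_minus degree_pderiv)
  then have "pderiv (p - q) = 0" by (simp add: pderiv_eq_0_iff)
  with * show "p = q" by simp
qed

text \<open>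
  The exponential generating function in $t$ of a sequence of polynomials in $x$, as a complex
  function and, for each fixed $x$, as a formal power series in $t$.
\<close>

definition egf :: "(nat \<Rightarrow> complex poly) \<Rightarrow> complex \<Rightarrow> complex \<Rightarrow> complex" where
  "egf p x t = (\<Sum>n. 1 / fact n * poly (p n) x * t ^ n)"

definition egf_fps :: "(nat \<Rightarrow> complex poly) \<Rightarrow> complex \<Rightarrow> complex fps" where
  "egf_fps p x = Abs_fps (\<lambda>n. 1 / fact n * poly (p n) x)"

end

(*
  Differentiating the equations and using uniqueness of polynomial solutions shows that
  e_(n+1)' = (n+1) e_n and c_(n+2)'' = (n+2)(n+1) c_n.  Substituting back gives recurrences without
  derivatives, which say that E (1 + t) and C (1 + t^2) are the exponential series.  The
  denominators have no zeros in the unit disc, so these formal quotients converge there.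
*)
theory Submission
  imports Defs "HOL-Complex_Analysis.Cauchy_Integral_Formula"
begin

lemma poly_ode1_unique:
  fixes p q :: "complex poly"
  assumes "pderiv p + p = r" "pderiv q + q = r"
  shows "p = q"
  using assms poly_ode1_ex1[of r] by blast

lemma poly_ode2_unique:
  fixes p q :: "complex poly"
  assumes "pderiv (pderiv p) + p = r" "pderiv (pderiv q) + q = r"
  shows "p = q"
  using assms poly_ode2_ex1[of r] by blast

text \<open>Both sides solve \<open>pderiv q + q = monom (of_nat (Suc n)) n\<close>: the left by
  differentiating the equation of index \<open>Suc n\<close>, the right by scaling that of index
  \<open>n\<close>.\<close>

lemma pderiv_ode1_solution_Suc:
  fixes e :: "nat \<Rightarrow> complex poly"
  assumes e: "\<And>n. pderiv (e n) + e n = monom 1 n"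
  shows "pderiv (e (Suc n)) = smult (of_nat (Suc n)) (e n)"
proof -
  have "pderiv (pderiv (e (Suc n))) + pderiv (e (Suc n)) = monom (of_nat (Suc n)) n"
    using arg_cong[OF e[of "Suc n"], of pderiv] by (simp add: pderiv_add pderiv_monom)
  moreover have "pderiv (smult (of_nat (Suc n)) (e n)) + smult (of_nat (Suc n)) (e n)
      = monom (of_nat (Suc n)) n"
    unfolding pderiv_smult smult_add_right[symmetric] e by (simp add: smult_monom)
  ultimately show ?thesis
    by (rule poly_ode1_unique)
qed

text \<open>The second-order equation has to be differentiated twice to be compared with a multiple
  of an earlier one, hence the index step of two.\<close>

lemma pderiv2_ode2_solution_Suc_Suc:
  fixes c :: "nat \<Rightarrow> complex poly"
  assumes c: "\<And>n. pderiv (pderiv (c n)) + c n = monom 1 n"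
  shows "pderiv (pderiv (c (Suc (Suc n)))) = smult (of_nat (Suc (Suc n)) * of_nat (Suc n)) (c n)"
proof -
  let ?k = "of_nat (Suc (Suc n)) * of_nat (Suc n) :: complex"
  have "pderiv (pderiv (pderiv (pderiv (c (Suc (Suc n)))))) + pderiv (pderiv (c (Suc (Suc n))))
      = monom ?k n"
    using arg_cong[OF c[of "Suc (Suc n)"], of "\<lambda>p. pderiv (pderiv p)"]
    by (simp add: pderiv_add pderiv_monom mult.commute)
  moreover have "pderiv (pderiv (smult ?k (c n))) + smult ?k (c n) = monom ?k n"
    unfolding pderiv_smult smult_add_right[symmetric] c by (simp add: smult_monom)
  ultimately show ?thesis
    by (rule poly_ode2_unique)
qed

lemma fps_eq_divide_unit:
  fixes f g h :: "'a :: field fps"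
  assumes "f * g = h" "fps_nth g 0 \<noteq> 0"
  shows "f = h / g"
  unfolding assms(1)[symmetric] using assms(2) by (subst nonzero_mult_div_cancel_right) auto

lemma egf_fps_ode1:
  fixes e :: "nat \<Rightarrow> complex poly"
  assumes e: "\<And>n. pderiv (e n) + e n = monom 1 n"
  shows "egf_fps e x = fps_exp x / (1 + fps_X)"
proof -
  have 0: "e 0 = 1"
    by (rule poly_ode1_unique[of _ 1]) (use e[of 0] in simp_all)
  have "poly (e (Suc n)) x = x ^ Suc n - of_nat (Suc n) * poly (e n) x" for n
    using arg_cong[OF e[of "Suc n"], of "\<lambda>p. poly p x"]
    unfolding pderiv_ode1_solution_Suc[of e, OF e]
    by (simp add: poly_monom algebra_simps)
  \<comment> \<open>Division by \<open>fact (Suc n)\<close> absorbs the factor \<open>Suc n\<close>;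
    what remains is the comparison of coefficients of index \<open>Suc n\<close> in E (1 + X) =
    exp(x X).\<close>
  then have Suc: "poly (e (Suc n)) x / fact (Suc n)
      = x ^ Suc n / fact (Suc n) - poly (e n) x / fact n" for n
    by (simp add: diff_divide_distrib fact_Suc del: of_nat_Suc)
  have "egf_fps e x * (1 + fps_X) = fps_exp x"
  proof (rule fps_ext)
    fix n
    show "fps_nth (egf_fps e x * (1 + fps_X)) n = fps_nth (fps_exp x) n"
      by (cases n) (simp_all add: egf_fps_def distrib_left 0 Suc del: fact_Suc of_nat_Suc)
  qed
  then show ?thesis
    by (rule fps_eq_divide_unit) simp
qed

lemma egf_fps_ode2:
  fixes c :: "nat \<Rightarrow> complex poly"
  assumes c: "\<And>n. pderiv (pderiv (c n)) + c n = monom 1 n"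
  shows "egf_fps c x = fps_exp x / (1 + fps_X ^ 2)"
proof -
  have 0: "c 0 = 1"
    by (rule poly_ode2_unique[of _ 1]) (use c[of 0] in simp_all)
  \<comment> \<open>The recurrence below moves by two indices, so it needs two initial
    values.\<close>
  have 1: "c (Suc 0) = monom 1 1"
    by (rule poly_ode2_unique[of _ "monom 1 1"]) (use c[of 1] in \<open>simp_all add: pderiv_monom\<close>)
  have "poly (c (Suc (Suc n))) x
      = x ^ Suc (Suc n) - of_nat (Suc (Suc n)) * of_nat (Suc n) * poly (c n) x" for n
    using arg_cong[OF c[of "Suc (Suc n)"], of "\<lambda>p. poly p x"]
    unfolding pderiv2_ode2_solution_Suc_Suc[of c, OF c]
    by (simp add: poly_monom algebra_simps)
  then have Suc: "poly (c (Suc (Suc n))) x / fact (Suc (Suc n))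
      = x ^ Suc (Suc n) / fact (Suc (Suc n)) - poly (c n) x / fact n" for n
    by (simp add: diff_divide_distrib fact_Suc del: of_nat_Suc)
  have "egf_fps c x * (1 + fps_X ^ 2) = fps_exp x"
  proof (rule fps_ext)
    fix n
    consider "n = 0" | "n = 1" | m where "n = Suc (Suc m)"
      by (metis One_nat_def not0_implies_Suc)
    then show "fps_nth (egf_fps c x * (1 + fps_X ^ 2)) n = fps_nth (fps_exp x) n"
      by cases
        (simp_all add: egf_fps_def distrib_left 0 1 Suc fps_X_power_mult_right_nth poly_monom
          del: fact_Suc)
  qed
  then show ?thesis
    by (rule fps_eq_divide_unit) simp
qed

text \<open>Partial fractions: 2/(1 + X^2) = 1/(1 - iX) + 1/(1 + iX). The arguments ix and -ix
  compensate the substitutions, so both exponentials become exp(x X).\<close>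

lemma fps_exp_over_one_plus_X_squared:
  "2 * (fps_exp x / (1 + fps_X ^ 2)) =
    (fps_exp (\<i> * x) / (1 + fps_X) oo (fps_const (- \<i>) * fps_X)) +
    (fps_exp (- \<i> * x) / (1 + fps_X) oo (fps_const \<i> * fps_X))"
proof -
  \<comment> \<open>These are the images of \<open>1 + fps_X\<close> under the two substitutions;
    their product is the common denominator and their sum is constant.\<close>
  define P Q :: "complex fps"
    where "P = 1 + fps_const (- \<i>) * fps_X" and "Q = 1 + fps_const \<i> * fps_X"
  have unit: "fps_nth P 0 \<noteq> 0" "fps_nth Q 0 \<noteq> 0" "fps_nth (P * Q) 0 \<noteq> 0"
    by (simp_all add: P_def Q_def)
  have "P * Q = 1 + (fps_const (- \<i>) + fps_const \<i>) * fps_X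
      + (fps_const (- \<i>) * fps_const \<i>) * fps_X ^ 2"
    unfolding P_def Q_def by algebra
  then have PQ: "P * Q = 1 + fps_X ^ 2"
    by simp
  have sum: "P + Q = 2"
    unfolding P_def Q_def by (simp add: fps_eq_iff fps_numeral_nth)
  have 1: "(fps_exp (\<i> * x) / (1 + fps_X) oo (fps_const (- \<i>) * fps_X)) = fps_exp x / P"
    unfolding P_def
    by (subst fps_divide_compose) (simp_all add: fps_compose_add_distrib del: fps_const_neg)
  have 2: "(fps_exp (- \<i> * x) / (1 + fps_X) oo (fps_const \<i> * fps_X)) = fps_exp x / Q"
    unfolding Q_def by (subst fps_divide_compose) (simp_all add: fps_compose_add_distrib)
  \<comment> \<open>The divisions are exact because nonzero constant coefficients make
    \<open>P\<close> and \<open>Q\<close> units.\<close>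
  have cancel: "fps_exp x / P * P = fps_exp x" "fps_exp x / Q * Q = fps_exp x"
    using unit inverse_mult_eq_1 by (simp_all add: fps_divide_unit mult.assoc)
  \<comment> \<open>Regrouped so that each quotient stands next to its own denominator.\<close>
  have "(f + g) * (P * Q) = f * P * Q + g * Q * P" for f g
    by (simp only: distrib_right mult.assoc mult.commute[of P Q])
  then have "(fps_exp x / P + fps_exp x / Q) * (P * Q) = fps_exp x * Q + fps_exp x * P"
    by (simp only: cancel)
  also have "\<dots> = (P + Q) * fps_exp x"
    by (simp add: algebra_simps)
  also have "\<dots> = 2 * fps_exp x"
    by (simp only: sum)
  finally have "fps_exp x / P + fps_exp x / Q = 2 * fps_exp x / (P * Q)"
    using unit(3) by (rule fps_eq_divide_unit)
  also have "\<dots> = 2 * (fps_exp x / (P * Q))"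
    using unit(3) by (simp add: fps_divide_unit mult.assoc)
  finally show ?thesis
    by (simp only: 1 2 PQ)
qed

text \<open>Passage from formal to analytic identities: a quotient of entire functions is analytic
  on a disc where the denominator has no zero. The unit disc suits both denominators used below,
  whose zeros -1 and i, -i lie on its boundary.\<close>

lemma egf_of_egf_fps_quotient:
  fixes g :: "complex fps"
  assumes fps: "egf_fps p x = fps_exp x / g"
    and radius: "fps_conv_radius g = \<infinity>"
    and nonzero: "\<And>z. norm z < 1 \<Longrightarrow> eval_fps g z \<noteq> 0"
    and t: "norm t < 1"
  shows "summable (\<lambda>n. 1 / fact n * poly (p n) x * t ^ n)"
    and "egf p x t = exp (x * t) / eval_fps g t"
proof -
  have nz: "eval_fps g z \<noteq> 0" if "z \<in> eball 0 1" for z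
    using that nonzero by (simp add: in_eball_iff one_ereal_def)
  \<comment> \<open>Numerator and denominator have infinite radius, so the minimum is 1.\<close>
  have "fps_conv_radius (fps_exp x / g) \<ge> Min {1, fps_conv_radius (fps_exp x), fps_conv_radius g}"
    by (rule fps_conv_radius_divide') (use nz radius in auto)
  then have "ereal (norm t) < fps_conv_radius (egf_fps p x)"
    using t radius by (auto simp: fps one_ereal_def intro: less_le_trans[of _ "ereal 1"])
  from summable_fps[OF this] show "summable (\<lambda>n. 1 / fact n * poly (p n) x * t ^ n)"
    by (simp add: egf_fps_def)
  have "eval_fps (fps_exp x / g) t = eval_fps (fps_exp x) t / eval_fps g t"
    by (rule eval_fps_divide'[where r = 1]) (use nz radius t in \<open>auto simp: one_ereal_def\<close>)
  moreover have "egf p x t = eval_fps (egf_fps p x) t"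
    by (simp add: eval_fps_def egf_def egf_fps_def)
  ultimately show "egf p x t = exp (x * t) / eval_fps g t"
    by (simp add: fps)
qed

lemma one_plus_ne_0:
  fixes z :: "'a :: real_normed_algebra_1"
  assumes "norm z < 1"
  shows "1 + z \<noteq> 0"
  using assms by (auto simp: add_eq_0_iff)

lemma egf_ode1:
  fixes e :: "nat \<Rightarrow> complex poly"
  assumes e: "\<And>n. pderiv (e n) + e n = monom 1 n" and t: "norm t < 1"
  shows "summable (\<lambda>n. 1 / fact n * poly (e n) x * t ^ n)"
    and "egf e x t = exp (x * t) / (1 + t)"
proof -
  have radius: "fps_conv_radius (1 + fps_X :: complex fps) = \<infinity>"
    using fps_conv_radius_add[of "1 :: complex fps" fps_X] by simp
  have eval: "eval_fps (1 + fps_X) z = 1 + z" for z :: complex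
    by (simp add: eval_fps_add)
  note quotient = egf_of_egf_fps_quotient[OF egf_fps_ode1[of e, OF e] radius _ t, unfolded eval]
  show "summable (\<lambda>n. 1 / fact n * poly (e n) x * t ^ n)"
    and "egf e x t = exp (x * t) / (1 + t)"
    by (rule quotient; rule one_plus_ne_0; assumption)+
qed

lemma egf_ode2:
  fixes c :: "nat \<Rightarrow> complex poly"
  assumes c: "\<And>n. pderiv (pderiv (c n)) + c n = monom 1 n" and t: "norm t < 1"
  shows "summable (\<lambda>n. 1 / fact n * poly (c n) x * t ^ n)"
    and "egf c x t = exp (x * t) / (1 + t ^ 2)"
proof -
  have radius_sq: "fps_conv_radius (fps_X ^ 2 :: complex fps) = \<infinity>"
    using fps_conv_radius_power[of "fps_X :: complex fps" 2] by simp
  then have radius: "fps_conv_radius (1 + fps_X ^ 2 :: complex fps) = \<infinity>"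
    using fps_conv_radius_add[of "1 :: complex fps" "fps_X ^ 2"] by simp
  have eval: "eval_fps (1 + fps_X ^ 2) z = 1 + z ^ 2" for z :: complex
    by (simp add: eval_fps_add radius_sq)
  have nonzero: "1 + z ^ 2 \<noteq> 0" if "norm z < 1" for z :: complex
    using that by (intro one_plus_ne_0) (simp add: norm_power power_less_one_iff)
  note quotient = egf_of_egf_fps_quotient[OF egf_fps_ode2[of c, OF c] radius _ t, unfolded eval]
  show "summable (\<lambda>n. 1 / fact n * poly (c n) x * t ^ n)"
    and "egf c x t = exp (x * t) / (1 + t ^ 2)"
    by (rule quotient; rule nonzero; assumption)+
qed

theorem mainTheorem9:
  fixes s c e :: "nat \<Rightarrow> complex poly"
  assumes s: "\<And>n. pderiv (pderiv (s n)) + s n = - monom 1 n"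
    and c: "\<And>n. pderiv (pderiv (c n)) + c n = monom 1 n"
    and e: "\<And>n. pderiv (e n) + e n = monom 1 n"
  shows
    \<comment> \<open>convergent power series in \<open>t\<close>, for every complex \<open>x\<close>; all three diverge when \<open>norm t \<ge> 1\<close>\<close>
    "(\<forall>x t :: complex. norm t < 1 \<longrightarrow>
        summable (\<lambda>n. 1 / fact n * poly (s n) x * t ^ n) \<and>
        summable (\<lambda>n. 1 / fact n * poly (c n) x * t ^ n) \<and>
        summable (\<lambda>n. 1 / fact n * poly (e n) x * t ^ n) \<and>
        egf s x t = - exp (x * t) / (1 + t ^ 2) \<and>
        egf c x t = exp (x * t) / (1 + t ^ 2) \<and>
        egf e x t = exp (x * t) / (1 + t) \<and>
        - 2 * egf s x t = 2 * egf c x t \<and>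
        2 * egf c x t = egf e (\<i> * x) (- \<i> * t) + egf e (- \<i> * x) (\<i> * t)) \<and>
    \<comment> \<open>formal power series in \<open>t\<close>\<close>
     (\<forall>x :: complex.
        egf_fps s x = - fps_exp x / (1 + fps_X ^ 2) \<and>
        egf_fps c x = fps_exp x / (1 + fps_X ^ 2) \<and>
        egf_fps e x = fps_exp x / (1 + fps_X) \<and>
        - 2 * egf_fps s x = 2 * egf_fps c x \<and>
        2 * egf_fps c x =
          (egf_fps e (\<i> * x) oo (fps_const (- \<i>) * fps_X)) +
          (egf_fps e (- \<i> * x) oo (fps_const \<i> * fps_X)))"
proof -
  \<comment> \<open>By linearity \<open>- c n\<close> solves the equation of \<open>s n\<close>, so
    every claim about S reduces to one about C.\<close>
  have s_eq: "s n = - c n" for n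
  proof -
    have "pderiv (pderiv (- c n)) + - c n = - monom 1 n"
      unfolding pderiv_minus c[symmetric] by simp
    with s[of n] show ?thesis
      by (rule poly_ode2_unique)
  qed
  have fps_s: "egf_fps s x = - egf_fps c x" for x
    by (simp add: fps_eq_iff egf_fps_def s_eq)
  have summable_s: "summable (\<lambda>n. 1 / fact n * poly (s n) x * t ^ n)" if "norm t < 1" for x t
    using summable_minus[OF egf_ode2(1)[of c, OF c that]] by (simp add: s_eq)
  have egf_s: "egf s x t = - egf c x t" if "norm t < 1" for x t
    using suminf_minus[OF egf_ode2(1)[of c, OF c that]] by (simp add: egf_def s_eq)
  \<comment> \<open>The same partial fractions, now for the closed forms of the sums; multiplying
    \<open>t\<close> by a number of modulus 1 keeps it in the unit disc, where these forms
    hold.\<close>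
  have egf_e: "egf e (\<i> * x) (- \<i> * t) + egf e (- \<i> * x) (\<i> * t) = 2 * egf c x t"
    if t: "norm t < 1" for x t
  proof -
    have norms: "norm (- \<i> * t) < 1" "norm (\<i> * t) < 1"
      using t by (simp_all add: norm_mult)
    note norms[THEN one_plus_ne_0]
    moreover have "1 + t ^ 2 = (1 + - \<i> * t) * (1 + \<i> * t)"
      by (simp add: algebra_simps power2_eq_square)
    moreover have "\<i> * x * (- \<i> * t) = x * t" "- \<i> * x * (\<i> * t) = x * t"
      by (simp_all add: algebra_simps)
    ultimately show ?thesis
      unfolding egf_ode1(2)[of e, OF e norms(1)] egf_ode1(2)[of e, OF e norms(2)]
        egf_ode2(2)[of c, OF c t]
      by (simp add: divide_simps) (simp add: algebra_simps)
  qed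
  have analytic: "egf s x t = - exp (x * t) / (1 + t ^ 2)" "- 2 * egf s x t = 2 * egf c x t"
    if "norm t < 1" for x t
    using egf_ode2(2)[of c, OF c that] by (simp_all add: egf_s[OF that])
  \<comment> \<open>Rewriting division by a unit as multiplication by its inverse lets the minus
    sign pass through the quotient.\<close>
  have formal: "egf_fps s x = - fps_exp x / (1 + fps_X ^ 2)"
      "- 2 * egf_fps s x = 2 * egf_fps c x" for x
    by (simp_all add: fps_s egf_fps_ode2[of c, OF c] fps_divide_unit)
  have compose: "2 * egf_fps c x = (egf_fps e (\<i> * x) oo (fps_const (- \<i>) * fps_X)) +
      (egf_fps e (- \<i> * x) oo (fps_const \<i> * fps_X))" for x
    unfolding egf_fps_ode1[of e, OF e] egf_fps_ode2[of c, OF c]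
    by (rule fps_exp_over_one_plus_X_squared)
  show ?thesis
    by (intro conjI allI impI; (rule summable_s analytic egf_e[symmetric] egf_ode1[of e, OF e]
          egf_ode2[of c, OF c] formal compose egf_fps_ode1[of e, OF e] egf_fps_ode2[of c, OF c])?)
qed

end
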